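(* Let $m>1$ be an integer. Define $sf(n,m)$ for integers $n$ by $sf(n,m)=0$ for $n<0$, $sf(0,m)=1$, and for $n>0$: $sf(n,m)=sf(n/m,m)$ if $n\equiv 0\pmod m$, and $sf(n,m)=sf(n-r,m)+sf(n-m,m)$ if $n\equiv r\pmod m$ with $0<r<m$. Let $nd(n,m)$ be the number of partitions of $n$ into parts that are powers of $m$ (i.e. parts in $\{1,m,m^2,\dots\}$) in which the multiplicity of each part that occurs is not divisible by $m$. Then for every integer $n\ge0$, $sf(n,m)=nd(n,m)$.
   Context: $sf(n,m)$ equals the number of semi-$m$-Fibonacci partitions of $n$; the recurrence given characterizes it. The empty partition is counted for $n=0$, so $nd(0,m)=1$. *)

theory Defs
  imports "HOL-Library.Multiset"
begin

text \<open>
  The clause for \<open>m \<le> 1\<close> only makes the function total; the recurrence is meant for \<open>m > 1\<close>.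
  The residue \<open>r\<close> with \<open>0 < r < m\<close> is \<open>n mod m\<close>.
\<close>

function sf :: "int \<Rightarrow> int \<Rightarrow> nat" where
  "sf n m =
     (if n < 0 then 0
      else if n = 0 then 1
      else if m \<le> 1 then 0
      else if n mod m = 0 then sf (n div m) m
      else sf (n - n mod m) m + sf (n - m) m)"
  by pat_completeness auto

termination
proof (relation "measure (\<lambda>(n, m). nat n)")
  fix n m :: int
  assume h: "\<not> n < 0" "n \<noteq> 0" "\<not> m \<le> 1"
  {
    from h have "n div m < n"
      using int_div_less_self[of n m] by simp
    then show "((n div m, m), (n, m)) \<in> measure (\<lambda>(n, m). nat n)"
      using h by auto
  next
    assume "n mod m \<noteq> 0"
    moreover from h have "0 \<le> n mod m"
      by simp
    ultimately have "0 < n mod m"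
      by linarith
    then show "((n - n mod m, m), (n, m)) \<in> measure (\<lambda>(n, m). nat n)"
      using h by auto
  next
    show "((n - m, m), (n, m)) \<in> measure (\<lambda>(n, m). nat n)"
      using h by auto
  }
qed simp

declare sf.simps [simp del]

lemma sf_neg: "n < 0 \<Longrightarrow> sf n m = 0"
  by (subst sf.simps) simp

lemma sf_zero: "sf 0 m = 1"
  by (subst sf.simps) simp

lemma sf_dvd:
  assumes "m > 1" "n > 0" "m dvd n"
  shows "sf n m = sf (n div m) m"
  using assms by (subst sf.simps) (auto simp: mod_eq_0_iff_dvd)

lemma sf_not_dvd:
  assumes "m > 1" "n > 0" "n mod m = r" "0 < r"
  shows "sf n m = sf (n - r) m + sf (n - m) m"
  using assms by (subst sf.simps) auto

definition partitions :: "int \<Rightarrow> int multiset set" where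
  "partitions n = {P. (\<forall>p\<in>#P. 0 < p) \<and> sum_mset P = n}"

definition nd_partitions :: "int \<Rightarrow> int \<Rightarrow> int multiset set" where
  "nd_partitions n m =
     {P \<in> partitions n. (\<forall>p\<in>#P. \<exists>k::nat. p = m ^ k) \<and> (\<forall>p\<in>#P. \<not> m dvd int (count P p))}"

definition nd :: "int \<Rightarrow> int \<Rightarrow> nat" where
  "nd n m = card (nd_partitions n m)"

lemma finite_partitions: "finite (partitions n)"
proof (rule finite_subset)
  show "partitions n \<subseteq> mset ` {xs. set xs \<subseteq> {1..n} \<and> length xs \<le> nat n}"
  proof
    fix P assume "P \<in> partitions n"
    then have pos: "\<forall>p\<in>#P. 0 < p" and s: "sum_mset P = n"
      by (auto simp: partitions_def)
    obtain xs where xs: "P = mset xs"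
      by (metis ex_mset)
    have "int (length ys) \<le> sum_list ys \<and> (\<forall>y\<in>set ys. y \<le> sum_list ys)"
      if "\<forall>y\<in>set ys. 0 < y" for ys :: "int list"
      using that by (induction ys) force+
    with pos s xs have "int (length xs) \<le> n" "\<forall>y\<in>set xs. y \<le> n" "\<forall>y\<in>set xs. 1 \<le> y"
      by (auto simp: sum_mset_sum_list)
    then show "P \<in> mset ` {xs. set xs \<subseteq> {1..n} \<and> length xs \<le> nat n}"
      unfolding xs by (intro imageI) auto
  qed
  show "finite (mset ` {xs. set xs \<subseteq> {1..n} \<and> length xs \<le> nat n})"
    by (intro finite_imageI finite_lists_length_le) simp
qed

lemma finite_nd_partitions: "finite (nd_partitions n m)"
  by (rule finite_subset[OF _ finite_partitions]) (auto simp: nd_partitions_def)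

end

theory Submission
  imports Defs
begin

text \<open>
  The number \<open>nd n m\<close> obeys the recurrence of \<open>sf\<close>. All powers of \<open>m\<close> other than \<open>1\<close> are divisible
  by \<open>m\<close>, so the multiplicity \<open>c\<close> of \<open>1\<close> is congruent to \<open>n\<close> modulo \<open>m\<close>. If \<open>m\<close> divides \<open>n\<close>, this
  forces \<open>c = 0\<close>, and all parts can be divided by \<open>m\<close>. If \<open>n mod m = r > 0\<close>, then either \<open>c = r\<close>, and
  deleting the ones leaves a partition of \<open>n - r\<close>, or \<open>c > m\<close>, and deleting \<open>m\<close> of the ones leaves a
  partition of \<open>n - m\<close>.
\<close>

text \<open>Powers of \<open>m > 1\<close> are positive, so membership in
  \<open>partitions n\<close> reduces to the condition on the sum.\<close>

lemma nd_partitions_iff: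
  assumes "m > 1"
  shows "P \<in> nd_partitions n m \<longleftrightarrow>
    sum_mset P = n \<and> (\<forall>p\<in>#P. (\<exists>k::nat. p = m ^ k) \<and> \<not> m dvd int (count P p))"
  using assms by (fastforce simp: nd_partitions_def partitions_def)

lemma sum_mset_nonneg_int:
  fixes P :: "int multiset"
  shows "(\<And>p. p \<in># P \<Longrightarrow> 0 \<le> p) \<Longrightarrow> 0 \<le> sum_mset P"
  by (induction P) auto

lemma dvd_sum_mset:
  fixes P :: "'a::comm_semiring_1 multiset"
  shows "(\<And>p. p \<in># P \<Longrightarrow> d dvd p) \<Longrightarrow> d dvd sum_mset P"
  by (induction P) auto

lemma count_one_mod:
  assumes m: "m > 1" and P: "P \<in> nd_partitions n m"
  shows "int (count P 1) mod m = n mod m"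
proof -
  have "m dvd p" if p: "p \<in># P" "p \<noteq> 1" for p
  proof -
    obtain k where "p = m ^ k"
      using P p(1) by (auto simp: nd_partitions_iff[OF m])
    with p(2) show ?thesis
      by (cases k) auto
  qed
  then have "m dvd sum_mset (filter_mset (\<lambda>p. p \<noteq> 1) P)"
    by (intro dvd_sum_mset) auto
  moreover have "n = int (count P 1) + sum_mset (filter_mset (\<lambda>p. p \<noteq> 1) P)"
  proof -
    have "P = replicate_mset (count P 1) 1 + filter_mset (\<lambda>p. p \<noteq> 1) P"
      by (rule multiset_eqI) auto
    then have "sum_mset P = sum_mset (replicate_mset (count P 1) 1 + filter_mset (\<lambda>p. p \<noteq> 1) P)"
      by (rule arg_cong)
    then show ?thesis
      using P by (simp add: nd_partitions_iff[OF m])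
  qed
  ultimately show ?thesis
    by (metis add.right_neutral dvd_imp_mod_0 mod_add_right_eq)
qed

lemma one_notin_nd_partition:
  assumes m: "m > 1" and P: "P \<in> nd_partitions n m" and "m dvd n"
  shows "1 \<notin># P"
proof
  assume "1 \<in># P"
  then have "\<not> m dvd int (count P 1)"
    using P by (auto simp: nd_partitions_iff[OF m])
  then show False
    using count_one_mod[OF m P] assms(3) by (simp add: dvd_eq_mod_eq_0)
qed

lemma nd_neg:
  assumes "n < 0"
  shows "nd n m = 0"
proof -
  have "nd_partitions n m = {}"
    using assms sum_mset_nonneg_int by (force simp: nd_partitions_def partitions_def)
  then show ?thesis
    by (simp add: nd_def)
qed

lemma nd_zero: "nd 0 m = 1"
proof -
  have "P = {#}" if "\<forall>p\<in>#P. 0 < p" "sum_mset P = 0" for P :: "int multiset"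
  proof (cases P)
    case (add x Q)
    then have "0 \<le> sum_mset Q" "0 < x"
      using that(1) by (auto intro!: sum_mset_nonneg_int simp: less_imp_le)
    then show ?thesis
      using add that(2) by simp
  qed
  then have "nd_partitions 0 m = {{#}}"
    by (auto simp: nd_partitions_def partitions_def)
  then show ?thesis
    by (simp add: nd_def)
qed

lemma count_image_mset_inj:
  assumes "inj f"
  shows "count (image_mset f Q) (f x) = count Q x"
  using assms by (induction Q) (auto simp: inj_eq)

lemma sum_mset_image_times:
  fixes c :: "'a::semiring_0"
  shows "sum_mset (image_mset ((*) c) Q) = c * sum_mset Q"
  using sum_mset_distrib_left[of c id Q] by simp

text \<open>Multiplying every part by \<open>m\<close> is the bijection. As an injective map on
  parts it carries multiplicities over unchanged; it is onto because 1 is not a part when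
  \<open>m dvd n\<close>, so every part has a factor \<open>m\<close>.\<close>

lemma nd_dvd:
  assumes m: "m > 1" and "m dvd n"
  shows "nd n m = nd (n div m) m"
proof -
  have inj: "inj ((*) m)"
    using m by (simp add: inj_on_def)
  have "bij_betw (image_mset ((*) m)) (nd_partitions (n div m) m) (nd_partitions n m)"
    unfolding bij_betw_def
  proof (intro conjI set_eqI iffI)
    have "inj (image_mset ((*) m))"
      using inj by (rule multiset.inj_map)
    then show "inj_on (image_mset ((*) m)) (nd_partitions (n div m) m)"
      by (rule inj_on_subset) simp
  next
    fix P assume "P \<in> image_mset ((*) m) ` nd_partitions (n div m) m"
    then obtain Q where P: "P = image_mset ((*) m) Q" and Q: "Q \<in> nd_partitions (n div m) m"
      by auto
    have "\<exists>k. m * q = m ^ k" if "q \<in># Q" for q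
      using Q that by (metis nd_partitions_iff[OF m] power_Suc)
    then show "P \<in> nd_partitions n m"
      using Q \<open>m dvd n\<close>
      by (auto simp: nd_partitions_iff[OF m] P sum_mset_image_times count_image_mset_inj[OF inj])
  next
    fix P assume P: "P \<in> nd_partitions n m"
    define Q where "Q = image_mset (\<lambda>p. p div m) P"
    \<comment> \<open>The exponent is positive since \<open>p\<close> is not 1. This form makes
      \<open>p div m\<close> exact and again a power of \<open>m\<close>.\<close>
    have pow: "\<exists>k. p = m * m ^ k" if p: "p \<in># P" for p
    proof -
      obtain k where k: "p = m ^ k"
        using P p by (auto simp: nd_partitions_iff[OF m])
      have "p \<noteq> 1"
        using one_notin_nd_partition[OF m P \<open>m dvd n\<close>] p by auto
      with k show ?thesis
        by (cases k) auto
    qed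
    have PQ: "P = image_mset ((*) m) Q"
    proof -
      have "image_mset (\<lambda>p. m * (p div m)) P = image_mset id P"
        using pow m by (intro image_mset_cong) fastforce
      then show ?thesis
        by (simp add: Q_def image_mset.compositionality comp_def)
    qed
    have "\<exists>k. q = m ^ k" if "q \<in># Q" for q
      using that pow m by (fastforce simp: Q_def)
    moreover have "\<not> m dvd int (count Q q)" if "q \<in># Q" for q
    proof -
      have "m * q \<in># P"
        using that by (auto simp: PQ)
      then have "\<not> m dvd int (count P (m * q))"
        using P by (auto simp: nd_partitions_iff[OF m])
      then show ?thesis
        by (simp add: PQ count_image_mset_inj[OF inj])
    qed
    moreover have "sum_mset Q = n div m"
    proof -
      have "m * sum_mset Q = n"
        using P by (simp add: nd_partitions_iff[OF m] PQ sum_mset_image_times)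
      then show ?thesis
        using m by auto
    qed
    ultimately have "Q \<in> nd_partitions (n div m) m"
      by (auto simp: nd_partitions_iff[OF m])
    with PQ show "P \<in> image_mset ((*) m) ` nd_partitions (n div m) m"
      by blast
  qed
  then show ?thesis
    unfolding nd_def by (metis bij_betw_same_card)
qed

lemma nd_partitions_add_ones:
  assumes m: "m > 1" and P: "P \<in> nd_partitions n m"
    and c: "\<not> m dvd int (count P 1 + c)"
  shows "P + replicate_mset c 1 \<in> nd_partitions (n + int c) m"
proof -
  have "\<exists>k. (1::int) = m ^ k"
    by (rule exI[of _ 0]) simp
  then show ?thesis
    using P c by (auto simp: nd_partitions_iff[OF m])
qed

text \<open>The case \<open>count P 1 = 0\<close> is listed separately: 0 is divisible by
  \<open>m\<close>, but only parts that occur are constrained. It covers the removal of all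
  ones.\<close>

lemma nd_partitions_remove_ones:
  assumes m: "m > 1" and P: "P + replicate_mset c 1 \<in> nd_partitions n m"
    and c: "count P 1 = 0 \<or> \<not> m dvd int (count P 1)"
  shows "P \<in> nd_partitions (n - int c) m"
proof -
  have "\<not> m dvd int (count P p)" if "p \<in># P" for p
  proof (cases "p = 1")
    case True
    with that c show ?thesis by (auto simp: count_eq_zero_iff)
  next
    case False
    have "\<not> m dvd int (count (P + replicate_mset c 1) p)"
      using P that unfolding nd_partitions_iff[OF m] by simp
    with False show ?thesis by simp
  qed
  then show ?thesis
    using P by (auto simp: nd_partitions_iff[OF m])
qed

lemma nd_not_dvd:
  assumes m: "m > 1" and r: "n mod m = r" "0 < r"
  shows "nd n m = nd (n - r) m + nd (n - m) m"
proof -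
  define add where "add c P = P + replicate_mset (nat c) (1::int)" for c P
  \<comment> \<open>\<open>A\<close> collects the partitions with exactly \<open>r\<close> ones,
    \<open>B\<close> those with at least \<open>m\<close> ones.\<close>
  define A where "A = add r ` nd_partitions (n - r) m"
  define B where "B = add m ` nd_partitions (n - m) m"
  have rm: "r < m" and dvd: "m dvd n - r"
    using m r by (auto simp: mod_eq_dvd_iff[symmetric])
  have no_ones: "count P 1 = 0" if "P \<in> nd_partitions (n - r) m" for P
    using one_notin_nd_partition[OF m that dvd] by (simp add: not_in_iff)
  have ones: "int (count P 1) mod m = r" if "P \<in> nd_partitions (n - m) m" for P
    using count_one_mod[OF m that] r by simp
  have "nd_partitions n m = A \<union> B"
  proof (intro subset_antisym subsetI)
    fix P assume P: "P \<in> nd_partitions n m"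
    define c where "c = int (count P 1)"
    have c: "c mod m = r"
      using count_one_mod[OF m P] r by (simp add: c_def)
    \<comment> \<open>Multiset difference truncates; \<open>d \<le> c\<close> guarantees that enough
      ones are present for adding them back to restore \<open>P\<close>.\<close>
    have split: "P = add d (P - replicate_mset (nat d) 1)" if "d \<le> c" for d
      using that unfolding add_def c_def
      by (intro subset_mset.diff_add[symmetric]) (simp add: count_le_replicate_mset_subset_eq[symmetric] nat_le_iff)
    show "P \<in> A \<union> B"
    proof (cases "c < m")
      case True
      \<comment> \<open>Here \<open>0 \<le> c < m\<close>, so \<open>c\<close> is its own
        residue.\<close>
      then have cr: "c = r"
        using c by (simp add: c_def)
      have "P - replicate_mset (nat r) 1 \<in> nd_partitions (n - int (nat r)) m"
        using P split[of r] cr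
        by (intro nd_partitions_remove_ones[OF m]) (auto simp: add_def c_def)
      then show ?thesis
        using split[of r] cr r by (auto simp: A_def)
    next
      case False
      \<comment> \<open>The subtraction on naturals does not truncate because
        \<open>m \<le> c\<close>. The remaining number of ones keeps the residue
        \<open>r > 0\<close>, so it is not divisible by \<open>m\<close>.\<close>
      have "int (count P 1 - nat m) = c - m"
        using False m by (simp add: c_def of_nat_diff nat_le_iff)
      moreover have "\<not> m dvd c - m"
        using c r by (simp add: dvd_eq_mod_eq_0)
      ultimately have "P - replicate_mset (nat m) 1 \<in> nd_partitions (n - int (nat m)) m"
        using P split[of m] False
        by (intro nd_partitions_remove_ones[OF m]) (auto simp: add_def)
      then show ?thesis
        using split[of m] False m by (auto simp: B_def)
    qed
  next
    fix P assume "P \<in> A \<union> B"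
    then show "P \<in> nd_partitions n m"
    proof
      assume "P \<in> A"
      then obtain Q where Q: "Q \<in> nd_partitions (n - r) m" "P = add r Q"
        by (auto simp: A_def)
      \<comment> \<open>\<open>Q\<close> has no ones, so the new multiplicity is \<open>r\<close>,
        strictly between 0 and \<open>m\<close>.\<close>
      have "\<not> m dvd int (count Q 1 + nat r)"
        using no_ones[OF Q(1)] r rm by (simp add: zdvd_not_zless)
      from nd_partitions_add_ones[OF m Q(1) this] show ?thesis
        using r by (simp add: Q(2) add_def)
    next
      assume "P \<in> B"
      then obtain Q where Q: "Q \<in> nd_partitions (n - m) m" "P = add m Q"
        by (auto simp: B_def)
      have "\<not> m dvd int (count Q 1 + nat m)"
        using ones[OF Q(1)] r m by (simp add: dvd_eq_mod_eq_0)
      from nd_partitions_add_ones[OF m Q(1) this] show ?thesis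
        using m by (simp add: Q(2) add_def)
    qed
  qed
  moreover have "A \<inter> B = {}"
  proof -
    have "int (count P 1) = r" if "P \<in> A" for P
      using that no_ones r by (auto simp: A_def add_def)
    moreover have "m \<le> int (count P 1)" if "P \<in> B" for P
      using that m by (auto simp: B_def add_def)
    ultimately show ?thesis
      using rm by fastforce
  qed
  moreover have "finite A" "finite B"
    by (simp_all add: A_def B_def finite_nd_partitions)
  \<comment> \<open>Adding a fixed multiset is cancellable, hence injective.\<close>
  moreover have "card (add c ` S) = card S" for c S
    by (intro card_image) (simp add: add_def inj_on_def)
  ultimately show ?thesis
    by (simp add: nd_def card_Un_disjoint A_def B_def)
qed

text \<open>Negative \<open>n\<close> are included because the recursion passes to
  \<open>n - m\<close>, which is negative when \<open>n < m\<close>; both sides vanish there. The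
  induction follows the recursive calls of \<open>sf\<close>, and both functions satisfy the same
  recurrence.\<close>

lemma sf_eq_nd:
  assumes "m > 1"
  shows "sf n m = nd n m"
  using assms
proof (induction n m rule: sf.induct)
  case (1 n m)
  consider "n < 0" | "n = 0" | "n > 0" "m dvd n" | "n > 0" "\<not> m dvd n"
    by linarith
  then show ?case
  proof cases
    case 1
    then show ?thesis
      by (simp add: sf_neg nd_neg)
  next
    case 2
    then show ?thesis
      by (simp add: sf_zero nd_zero)
  next
    case 3
    then show ?thesis
      using "1.prems" "1.IH"(1) by (simp add: sf_dvd nd_dvd)
  next
    case 4
    then have r: "0 < n mod m"
      using "1.prems" by (simp add: dvd_eq_mod_eq_0 order_less_le)
    then show ?thesis
      using 4 "1.prems" "1.IH"(2,3)
      by (simp add: sf_not_dvd[OF _ _ refl r] nd_not_dvd[OF _ refl r])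
  qed
qed

theorem theorem3:
  fixes m n :: int
  assumes "m > 1" and "n \<ge> 0"
  shows "sf n m = nd n m"
  using assms(1) by (rule sf_eq_nd)

end
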